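(* For every integer $n\ge 0$, the following identity holds in $\mathbb{F}_2[x]$: $$\prod_{k=0}^{2^n-1}\left(1+\sum_{j=0}^{k}\binom{k}{j}x^{2^j}\right)=x^{2^{2^n}-1}+1,$$ where the binomial coefficients $\binom{k}{j}$ are reduced modulo $2$. *)

theory Defs
  imports "HOL-Library.Z2" "HOL-Computational_Algebra.Polynomial"
begin

end

theory Submission
  imports Defs "HOL-Computational_Algebra.Primes"
begin

text \<open>
  Put \<open>S k = (\<Sum>j\<le>k. (k choose j) * x^(2^j))\<close> and \<open>\<phi> f = f + f\<^sup>2\<close>. Since squaring is additive in
  characteristic 2, Pascal's rule says \<open>S (k + 1) = \<phi> (S k) = S k * (1 + S k)\<close>. Hence \<open>S m\<close> is
  \<open>x\<close> times the product of the \<open>1 + S k\<close> with \<open>k < m\<close>, and it is also the \<open>m\<close>-th iterate of the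
  additive map \<open>\<phi>\<close> at \<open>x\<close>. By repeated doubling the \<open>2^n\<close>-th iterate of \<open>\<phi>\<close> is
  \<open>f + f^(2^(2^n))\<close>; cancelling \<open>x\<close> gives the identity.
\<close>

lemma CHAR_bit: "CHAR(bit) = 2"
  by (rule CHAR_eq_posI) (auto simp: less_2_cases_iff)

lemma CHAR_bit_poly: "CHAR(bit poly) = 2"
  by (simp only: semiring_char_poly CHAR_bit)

lemma add_self_bit_poly: "p + p = (0 :: bit poly)"
  by (rule poly_eqI) (simp only: coeff_add, simp)

lemmas add_power_two_power_bit_poly =
  freshmans_dream' [where 'a = "bit poly", unfolded CHAR_bit_poly, OF two_is_prime_nat refl]

lemmas sum_square_bit_poly =
  freshmans_dream_sum [where 'a = "bit poly", unfolded CHAR_bit_poly, OF two_is_prime_nat refl]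

text \<open>With \<open>q = 2 ^ 2 ^ n\<close>, applying \<open>f + f ^ q\<close> twice gives
  \<open>f + f ^ q + f ^ q + (f ^ q) ^ q\<close>, because \<open>q\<close>-th powers are additive;
  the middle terms cancel.\<close>

lemma funpow_add_square:
  "((\<lambda>f. f + f\<^sup>2) ^^ 2 ^ n) f = f + (f ^ 2 ^ 2 ^ n :: bit poly)"
proof (induction n arbitrary: f)
  case (Suc n)
  have "(f ^ 2 ^ 2 ^ n) ^ 2 ^ 2 ^ n = f ^ 2 ^ 2 ^ Suc n"
    by (simp add: mult_2 power_add flip: power_mult)
  then show ?case
    by (simp add: mult_2 funpow_add Suc add_power_two_power_bit_poly add.assoc
        add_self_bit_poly flip: add.assoc [of "f ^ 2 ^ 2 ^ n"])
qed simp

definition binomial_linearized :: "nat \<Rightarrow> bit poly" where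
  "binomial_linearized k = (\<Sum>j = 0..k. monom (of_nat (k choose j)) (2 ^ j))"

lemma binomial_linearized_0: "binomial_linearized 0 = monom 1 1"
  by (simp add: binomial_linearized_def)

lemma binomial_linearized_Suc:
  "binomial_linearized (Suc k) = binomial_linearized k + (binomial_linearized k)\<^sup>2"
proof -
  let ?m = "\<lambda>k j. monom (of_nat (k choose j) :: bit) (2 ^ j)"
  \<comment> \<open>Both elements of the field equal their own squares, so only the exponent
    changes.\<close>
  have square: "(monom c i)\<^sup>2 = monom c (2 * i)" for c :: bit and i
    by (cases c) (simp_all add: monom_power mult.commute)
  have "binomial_linearized (Suc k) = ?m k 0 + (\<Sum>j = 0..k. ?m (Suc k) (Suc j))"
    unfolding binomial_linearized_def
    by (subst sum.atLeast0_atMost_Suc_shift) simp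
  also have "(\<Sum>j = 0..k. ?m (Suc k) (Suc j)) =
      (\<Sum>j = 0..k. ?m k (Suc j)) + (\<Sum>j = 0..k. (?m k j)\<^sup>2)"
    by (simp add: square add_monom add.commute flip: sum.distrib)
  \<comment> \<open>The extra top term at \<open>j = Suc k\<close> vanishes, since
    \<open>k choose Suc k = 0\<close>.\<close>
  also have "?m k 0 + \<dots> = (\<Sum>j = 0..Suc k. ?m k j) + (\<Sum>j = 0..k. (?m k j)\<^sup>2)"
    by (subst sum.atLeast0_atMost_Suc_shift) (simp add: add.assoc)
  also have "\<dots> = binomial_linearized k + (binomial_linearized k)\<^sup>2"
    by (simp add: binomial_linearized_def binomial_eq_0 sum_square_bit_poly)
  finally show ?thesis .
qed

lemma binomial_linearized_eq_funpow:
  "binomial_linearized k = ((\<lambda>f. f + f\<^sup>2) ^^ k) (monom 1 1)"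
  by (induction k) (simp_all add: binomial_linearized_0 binomial_linearized_Suc)

lemma binomial_linearized_eq_prod:
  "binomial_linearized m = monom 1 1 * (\<Prod>k<m. 1 + binomial_linearized k)"
proof (induction m)
  case (Suc m)
  have "binomial_linearized (Suc m) = binomial_linearized m * (1 + binomial_linearized m)"
    by (simp add: binomial_linearized_Suc power2_eq_square algebra_simps)
  then show ?case
    by (simp add: Suc mult.assoc)
qed (simp add: binomial_linearized_0)

theorem theorem3:
  fixes n :: nat
  shows "(\<Prod>k = 0..2 ^ n - 1.
            1 + (\<Sum>j = 0..k. monom (of_nat (k choose j) :: bit) (2 ^ j)))
         = monom 1 (2 ^ (2 ^ n) - 1) + 1"
proof -
  have "monom 1 1 * (\<Prod>k<2 ^ n. 1 + binomial_linearized k) = binomial_linearized (2 ^ n)"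
    by (rule binomial_linearized_eq_prod [symmetric])
  also have "\<dots> = monom 1 1 + monom 1 (2 ^ 2 ^ n)"
    by (simp add: binomial_linearized_eq_funpow funpow_add_square monom_power)
  also have "\<dots> = monom 1 1 * (monom 1 (2 ^ 2 ^ n - 1) + 1)"
    by (simp add: distrib_left mult_monom add.commute)
  finally have "(\<Prod>k<2 ^ n. 1 + binomial_linearized k) = monom 1 (2 ^ 2 ^ n - 1) + 1"
    by (simp only: mult_cancel_left monom_eq_0_iff) simp
  \<comment> \<open>Truncated subtraction is harmless here because \<open>2 ^ n\<close> is at least
    1.\<close>
  moreover have "{0..2 ^ n - 1} = {..<2 ^ n :: nat}"
    by (auto simp: le_diff_conv2 Suc_le_eq)
  ultimately show ?thesis
    by (simp only: binomial_linearized_def)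
qed

end
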